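(* Let $\mathcal{A}$ be the online algorithm described in the context, built from an $(\alpha,\beta)$-approximation algorithm for the minimum unscheduled weight problem (MUWP) and a $\gamma$-approximation algorithm for the offline problem with identical release times. Then for every instance, \[ \sum_{j\in J} w_j C_j^{\mathcal{A}} \le (2\alpha\beta+\gamma)\sum_{j\in J} w_j C_j^{\mathcal{OPT}} + \alpha W, \] where $C_j^{\mathcal{OPT}}$ is the completion time of job $j$ in an optimal offline schedule (which respects release times) and $W=\sum_{j\in J} w_j$. That is, $\mathcal{A}$ is $(2\alpha\beta+\gamma)$-competitive with an additive $\alpha W$ term.
   Context: Fix a scheduling environment (for example, concurrent open shop) with a set $J$ of jobs; each job $j$ has a weight $w_j\ge 0$ and a release time $r_j\ge 0$, and no part of job $j$ may be processed before $r_j$. $C_j$ denotes the completion time of $j$, and the objective is to minimize $\sum_j w_jC_j$. Schedules of disjoint sets of jobs placed in disjoint time intervals can be combined into one schedule. Standing assumption: all processing times are at least $1$. In the online version, job $j$ (with its data) becomes known only at time $r_j$. Minimum unscheduled weight problem (MUWP): given a set of jobs with non-negative weights and a deadline $D$, find a subset $S$ of the jobs that can be completed by time $D$ and minimizes the total weight of jobs not in $S$ (the unscheduled weight). An $(\alpha,\beta)$-approximation for the MUWP finds a subset of jobs that can be completed by time $\alpha D$ and whose unscheduled weight is at most $\beta$ times the minimum unscheduled weight among subsets that can be completed by $D$. A $\gamma$-approximation for the offline problem with identical release times takes a set of jobs, all available at time $0$, and outputs a schedule whose total weighted completion time is at most $\gamma$ times optimal; it is assumed that it does not increase the makespan of the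 given subset of jobs, so that when applied to a set returned by the $(\alpha,\beta)$-approximation with deadline $D$, its schedule completes by time $\alpha D$. Algorithm $\mathcal{A}$: let $\tau_0=0$ and $\tau_k=2^{k-1}$ for $k\ge1$, and let $I_k=[\tau_k,\tau_{k+1})$ and $\alpha I_k=[\alpha\tau_k,\alpha\tau_{k+1})$. At each time $\tau_k$, let $R(\tau_k)$ be the set of jobs released but not yet scheduled by $\mathcal{A}$ before $\tau_k$. Run the $(\alpha,\beta)$-approximation on $R(\tau_k)$ with deadline $D=\tau_{k+1}-\tau_k$, obtaining a set $S_k$. Schedule $S_k$ within $\alpha I_k$, starting at time $\alpha\tau_k$, according to the schedule produced by the $\gamma$-approximation (which ignores release times). *)

theory Defs
  imports "HOL-Analysis.Analysis"
begin

text \<open>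
  A schedule records, for every job and every point in time, the set of activities
  (machines, ports, channels, \<dots>) that work on that job at that time; the empty set means
  that no part of the job is being processed.
\<close>

type_synonym ('j, 'm) schedule = "'j \<Rightarrow> real \<Rightarrow> 'm set"

definition busy :: "('j, 'm) schedule \<Rightarrow> 'j \<Rightarrow> real set" where
  "busy \<sigma> j = {t. \<sigma> j t \<noteq> {}}"

definition start_time :: "('j, 'm) schedule \<Rightarrow> 'j \<Rightarrow> ereal" where
  "start_time \<sigma> j = (INF t\<in>busy \<sigma> j. ereal t)"

text \<open>
  A job that is never processed has completion time \<open>\<infinity>\<close>.  As \<open>0 * \<infinity> = 0\<close> for extended reals,
  such a job contributes \<open>0\<close> to the objective if its weight is \<open>0\<close>, and makes the objective
  infinite otherwise.
\<close>

definition completion_time :: "('j, 'm) schedule \<Rightarrow> 'j \<Rightarrow> ereal" where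
  "completion_time \<sigma> j = (if busy \<sigma> j = {} then \<infinity> else (SUP t\<in>busy \<sigma> j. ereal t))"

definition cost :: "('j \<Rightarrow> real) \<Rightarrow> 'j set \<Rightarrow> ('j, 'm) schedule \<Rightarrow> ereal" where
  "cost w S \<sigma> = (\<Sum>j\<in>S. ereal (w j) * completion_time \<sigma> j)"

definition shift :: "real \<Rightarrow> ('j, 'm) schedule \<Rightarrow> ('j, 'm) schedule" where
  "shift s \<sigma> = (\<lambda>j t. \<sigma> j (t - s))"

definition restrict_jobs :: "'j set \<Rightarrow> ('j, 'm) schedule \<Rightarrow> ('j, 'm) schedule" where
  "restrict_jobs S \<sigma> = (\<lambda>j t. if j \<in> S then \<sigma> j t else {})"

definition combine :: "('j, 'm) schedule \<Rightarrow> ('j, 'm) schedule \<Rightarrow> ('j, 'm) schedule" where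
  "combine \<sigma> \<sigma>' = (\<lambda>j t. \<sigma> j t \<union> \<sigma>' j t)"

definition respects_release :: "('j \<Rightarrow> real) \<Rightarrow> ('j, 'm) schedule \<Rightarrow> bool" where
  "respects_release r \<sigma> \<longleftrightarrow> (\<forall>j. \<forall>t\<in>busy \<sigma> j. r j \<le> t)"


section \<open>Scheduling environments\<close>

text \<open>
  The type \<open>'j\<close> is the universe of all jobs together with their data; an instance is a finite
  set of jobs.  \<open>feasible S \<sigma>\<close> means that \<open>\<sigma>\<close> is a schedule of the environment, starting no
  earlier than time \<open>0\<close> and ignoring release times, that completely processes exactly the jobs
  in \<open>S\<close>.  Processing takes place in time slots that are open on the right, so that nothing is
  processed at the completion time itself.  \<open>p j\<close> is the processing time of \<open>j\<close>, of which we
  only record that every schedule spends at least that much time between starting and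
  completing \<open>j\<close>; if a job has several operations that may run in parallel, as in concurrent
  open shop, it is the longest of them.
\<close>

locale scheduling_environment =
  fixes feasible :: "'j set \<Rightarrow> ('j, 'm) schedule \<Rightarrow> bool"
    and p :: "'j \<Rightarrow> real"
    and r :: "'j \<Rightarrow> real"
    and w :: "'j \<Rightarrow> real"
  assumes weight_nonneg: "w j \<ge> 0"
    and release_nonneg: "r j \<ge> 0"
    and processing_ge_1: "p j \<ge> 1"
    and feasible_outside: "\<lbrakk>feasible S \<sigma>; j \<notin> S\<rbrakk> \<Longrightarrow> busy \<sigma> j = {}"
    and feasible_finite: "\<lbrakk>feasible S \<sigma>; j \<in> S\<rbrakk> \<Longrightarrow> completion_time \<sigma> j < \<infinity>"
    and feasible_time: "\<lbrakk>feasible S \<sigma>; t \<in> busy \<sigma> j\<rbrakk> \<Longrightarrow> 0 \<le> t \<and> ereal t < completion_time \<sigma> j"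
    and feasible_processing:
      "\<lbrakk>feasible S \<sigma>; j \<in> S\<rbrakk> \<Longrightarrow> start_time \<sigma> j + ereal (p j) \<le> completion_time \<sigma> j"
    and feasible_single: "\<exists>\<sigma>. feasible {j} \<sigma>"
    and feasible_restrict:
      "\<lbrakk>feasible S \<sigma>; S' \<subseteq> S\<rbrakk> \<Longrightarrow> feasible S' (restrict_jobs S' \<sigma>)"
    and feasible_shift: "\<lbrakk>feasible S \<sigma>; 0 \<le> s\<rbrakk> \<Longrightarrow> feasible S (shift s \<sigma>)"
    and feasible_combine:
      "\<lbrakk>feasible S \<sigma>; feasible S' \<sigma>'; S \<inter> S' = {};
        \<And>j. busy \<sigma> j \<subseteq> {..<b}; \<And>j. busy \<sigma>' j \<subseteq> {b..}\<rbrakk>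
       \<Longrightarrow> feasible (S \<union> S') (combine \<sigma> \<sigma>')"

text \<open>\<open>OPT\<close> may use full knowledge of the instance, but has to respect release times.\<close>

definition optimal_offline ::
    "('j set \<Rightarrow> ('j, 'm) schedule \<Rightarrow> bool) \<Rightarrow> ('j \<Rightarrow> real) \<Rightarrow> ('j \<Rightarrow> real) \<Rightarrow> 'j set
      \<Rightarrow> ('j, 'm) schedule \<Rightarrow> bool" where
  "optimal_offline feasible r w J \<sigma> \<longleftrightarrow>
     feasible J \<sigma> \<and> respects_release r \<sigma> \<and>
     (\<forall>\<sigma>'. feasible J \<sigma>' \<and> respects_release r \<sigma>' \<longrightarrow> cost w J \<sigma> \<le> cost w J \<sigma>')"


section \<open>The two offline subroutines\<close>

definition completes_by :: "'j set \<Rightarrow> ('j, 'm) schedule \<Rightarrow> real \<Rightarrow> bool" where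
  "completes_by S \<sigma> T \<longleftrightarrow> (\<forall>j\<in>S. completion_time \<sigma> j \<le> ereal T)"

definition completable ::
    "('j set \<Rightarrow> ('j, 'm) schedule \<Rightarrow> bool) \<Rightarrow> 'j set \<Rightarrow> real \<Rightarrow> bool" where
  "completable feasible S T \<longleftrightarrow> (\<exists>\<sigma>. feasible S \<sigma> \<and> completes_by S \<sigma> T)"

definition min_unscheduled_weight ::
    "('j set \<Rightarrow> ('j, 'm) schedule \<Rightarrow> bool) \<Rightarrow> ('j \<Rightarrow> real) \<Rightarrow> 'j set \<Rightarrow> real \<Rightarrow> real" where
  "min_unscheduled_weight feasible w R D =
     Min {sum w (R - S) | S. S \<subseteq> R \<and> completable feasible S D}"

definition muwp_approximation ::
    "('j set \<Rightarrow> ('j, 'm) schedule \<Rightarrow> bool) \<Rightarrow> ('j \<Rightarrow> real) \<Rightarrow> real \<Rightarrow> real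
      \<Rightarrow> ('j set \<Rightarrow> real \<Rightarrow> 'j set) \<Rightarrow> bool" where
  "muwp_approximation feasible w \<alpha> \<beta> select \<longleftrightarrow>
     (\<forall>R D. finite R \<and> D > 0 \<longrightarrow>
        select R D \<subseteq> R \<and>
        completable feasible (select R D) (\<alpha> * D) \<and>
        sum w (R - select R D) \<le> \<beta> * min_unscheduled_weight feasible w R D)"

definition offline_optimum ::
    "('j set \<Rightarrow> ('j, 'm) schedule \<Rightarrow> bool) \<Rightarrow> ('j \<Rightarrow> real) \<Rightarrow> 'j set \<Rightarrow> ereal" where
  "offline_optimum feasible w S = (INF \<sigma>\<in>{\<sigma>. feasible S \<sigma>}. cost w S \<sigma>)"

text \<open>The last conjunct says that the makespan of the given set of jobs is not increased.\<close>

definition offline_approximation ::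
    "('j set \<Rightarrow> ('j, 'm) schedule \<Rightarrow> bool) \<Rightarrow> ('j \<Rightarrow> real) \<Rightarrow> real
      \<Rightarrow> ('j set \<Rightarrow> ('j, 'm) schedule) \<Rightarrow> bool" where
  "offline_approximation feasible w \<gamma> sched \<longleftrightarrow>
     (\<forall>S. finite S \<longrightarrow>
        feasible S (sched S) \<and>
        cost w S (sched S) \<le> ereal \<gamma> * offline_optimum feasible w S \<and>
        (\<forall>T. completable feasible S T \<longrightarrow> completes_by S (sched S) T))"


section \<open>The online algorithm\<close>

definition \<tau> :: "nat \<Rightarrow> real" where
  "\<tau> k = (if k = 0 then 0 else 2 ^ (k - 1))"

text \<open>\<open>assigned \<dots> k\<close> is the set of jobs selected in the rounds before round \<open>k\<close>.\<close>

primrec assigned ::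
    "('j \<Rightarrow> real) \<Rightarrow> ('j set \<Rightarrow> real \<Rightarrow> 'j set) \<Rightarrow> 'j set \<Rightarrow> nat \<Rightarrow> 'j set" where
  "assigned r select J 0 = {}"
| "assigned r select J (Suc k) = assigned r select J k \<union>
     select ({j\<in>J. r j \<le> \<tau> k} - assigned r select J k) (\<tau> (Suc k) - \<tau> k)"

definition pending ::
    "('j \<Rightarrow> real) \<Rightarrow> ('j set \<Rightarrow> real \<Rightarrow> 'j set) \<Rightarrow> 'j set \<Rightarrow> nat \<Rightarrow> 'j set" where
  "pending r select J k = {j\<in>J. r j \<le> \<tau> k} - assigned r select J k"

definition batch ::
    "('j \<Rightarrow> real) \<Rightarrow> ('j set \<Rightarrow> real \<Rightarrow> 'j set) \<Rightarrow> 'j set \<Rightarrow> nat \<Rightarrow> 'j set" where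
  "batch r select J k = select (pending r select J k) (\<tau> (Suc k) - \<tau> k)"

definition online_schedule ::
    "('j \<Rightarrow> real) \<Rightarrow> real \<Rightarrow> ('j set \<Rightarrow> real \<Rightarrow> 'j set) \<Rightarrow> ('j set \<Rightarrow> ('j, 'm) schedule)
      \<Rightarrow> 'j set \<Rightarrow> ('j, 'm) schedule" where
  "online_schedule r \<alpha> select sched J =
     (\<lambda>j t. \<Union>k. shift (\<alpha> * \<tau> k) (sched (batch r select J k)) j t)"


section \<open>The online schedule is feasible and respects release times\<close>

lemma le_completion: "t \<in> busy \<sigma> j \<Longrightarrow> ereal t \<le> completion_time \<sigma> j"
  by (auto simp: completion_time_def intro: SUP_upper)

lemma busy_shift: "t \<in> busy (shift s \<sigma>) j \<longleftrightarrow> t - s \<in> busy \<sigma> j"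
  by (simp add: busy_def shift_def)

lemma tau_mono: "\<tau> k \<le> \<tau> (Suc k)" "\<tau> k < \<tau> (Suc k)" "0 \<le> \<tau> k"
  by (cases k; simp add: \<tau>_def)+

context scheduling_environment
begin

lemma feasible_empty: "feasible {} (\<lambda>j t. {})"
proof -
  obtain \<sigma> where "feasible {undefined} \<sigma>" using feasible_single by blast
  from feasible_restrict[OF this, of "{}"] show ?thesis by (simp add: restrict_jobs_def)
qed

lemma online_schedule_feasible:
  assumes J: "finite J" and \<alpha>: "\<alpha> \<ge> 1"
    and muwp: "muwp_approximation feasible w \<alpha> \<beta> select"
    and appr: "offline_approximation feasible w \<gamma> sched"
  shows "feasible (\<Union>k. batch r select J k) (online_schedule r \<alpha> select sched J)"
    and "respects_release r (online_schedule r \<alpha> select sched J)"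
proof -
  let ?B = "batch r select J" and ?A = "assigned r select J"
  define f where "f k = shift (\<alpha> * \<tau> k) (sched (?B k))" for k
  have pf: "finite (pending r select J k)" for k using J by (simp add: pending_def)
  have BP: "?B k \<subseteq> pending r select J k" for k
    using muwp pf[of k] tau_mono(2)[of k] unfolding muwp_approximation_def batch_def by auto
  have A: "?A (Suc k) = ?A k \<union> ?B k" for k by (simp add: batch_def pending_def)
  have fB: "finite (?B k)" for k using BP pf finite_subset by blast
  have cB: "completable feasible (?B k) (\<alpha> * (\<tau> (Suc k) - \<tau> k))" for k
    using muwp pf[of k] tau_mono(2)[of k] unfolding muwp_approximation_def batch_def by auto
  have feas: "feasible (?B k) (sched (?B k))" for k
    using appr fB unfolding offline_approximation_def by blast
  have fin: "completes_by (?B k) (sched (?B k)) (\<alpha> * (\<tau> (Suc k) - \<tau> k))" for k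
    using appr fB cB unfolding offline_approximation_def by blast
  have bf: "j \<in> ?B k \<and> t \<in> {\<alpha> * \<tau> k..<\<alpha> * \<tau> (Suc k)}" if "t \<in> busy (f k) j" for k t j
  proof -
    let ?u = "t - \<alpha> * \<tau> k"
    have u: "?u \<in> busy (sched (?B k)) j" using that by (simp add: f_def busy_shift)
    then have j: "j \<in> ?B k" using feasible_outside[OF feas] by blast
    have "ereal ?u < completion_time (sched (?B k)) j" "0 \<le> ?u" using feasible_time[OF feas u] by auto
    moreover have "completion_time (sched (?B k)) j \<le> ereal (\<alpha> * (\<tau> (Suc k) - \<tau> k))"
      using fin j by (auto simp: completes_by_def)
    ultimately have "ereal ?u < ereal (\<alpha> * (\<tau> (Suc k) - \<tau> k))" by (metis order_less_le_trans)
    then show ?thesis using j \<open>0 \<le> ?u\<close> by (simp add: algebra_simps)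
  qed
  have step: "feasible (?A K) (\<lambda>j t. \<Union>k<K. f k j t) \<and> (\<forall>j. busy (\<lambda>j t. \<Union>k<K. f k j t) j \<subseteq> {..<\<alpha> * \<tau> K})" for K
  proof (induction K)
    case 0 then show ?case using feasible_empty by (simp add: busy_def)
  next
    case (Suc K)
    let ?g = "\<lambda>j t. \<Union>k<K. f k j t"
    have eq: "(\<lambda>j t. \<Union>k<Suc K. f k j t) = combine ?g (f K)" by (auto simp: combine_def lessThan_Suc)
    have fk: "feasible (?B K) (f K)" unfolding f_def using feas \<alpha> tau_mono(3) by (intro feasible_shift) auto
    have "feasible (?A K \<union> ?B K) (combine ?g (f K))"
    proof (rule feasible_combine[where b = "\<alpha> * \<tau> K"])
      show "?A K \<inter> ?B K = {}" using BP[of K] by (auto simp: pending_def)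
    qed (use Suc fk bf in fastforce)+
    moreover have "t < \<alpha> * \<tau> (Suc K)" if t: "t \<in> busy (combine ?g (f K)) j" for t j
    proof -
      have "\<alpha> * \<tau> K \<le> \<alpha> * \<tau> (Suc K)" using \<alpha> tau_mono(1) by simp
      moreover have "t \<in> busy ?g j \<or> t \<in> busy (f K) j" using t by (auto simp: busy_def combine_def)
      ultimately show ?thesis using Suc bf[of t K j] by fastforce
    qed
    ultimately show ?case unfolding eq A by auto
  qed
  have AU: "?A K = (\<Union>k<K. ?B k)" for K by (induction K) (auto simp: A lessThan_Suc simp del: assigned.simps(2))
  have dis: "?B k \<inter> ?B l = {}" if "k < l" for k l
    using BP[of l] that AU[of l] by (auto simp: pending_def)
  have AJ: "?A K \<subseteq> J" for K using BP by (auto simp: AU pending_def)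
  have "finite (\<Union>k. ?B k)" using BP by (intro finite_subset[OF _ J]) (auto simp: pending_def)
  then obtain K where K: "(\<Union>k. ?B k) \<subseteq> ?A K"
  proof -
    assume fU: "finite (\<Union>k. ?B k)" and *: "\<And>K. (\<Union>k. ?B k) \<subseteq> ?A K \<Longrightarrow> thesis"
    have "\<forall>j\<in>(\<Union>k. ?B k). \<exists>k. j \<in> ?B k" by auto
    then obtain h where h: "\<And>j. j \<in> (\<Union>k. ?B k) \<Longrightarrow> j \<in> ?B (h j)" by metis
    let ?m = "Suc (Max (h ` (\<Union>k. ?B k)))"
    have "j \<in> ?A ?m" if "j \<in> (\<Union>k. ?B k)" for j
      unfolding AU using h[OF that] that fU by (force simp: less_Suc_eq_le intro!: Max_ge)
    then show thesis using * by blast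
  qed
  have U: "(\<Union>k. ?B k) = ?A K" using K by (auto simp: AU)
  have e: "f k j t = {}" if "\<not> k < K" for k j t
  proof (rule ccontr)
    assume "f k j t \<noteq> {}"
    then have "j \<in> ?B k" using bf by (auto simp: busy_def)
    moreover then have "j \<in> ?A K" using K by blast
    ultimately show False using dis that by (auto simp: AU) (metis disjoint_iff leD leI order_less_le_trans)
  qed
  have "online_schedule r \<alpha> select sched J = (\<lambda>j t. \<Union>k<K. f k j t)"
    unfolding online_schedule_def f_def[symmetric] using e by (intro ext) blast
  then show "feasible (\<Union>k. ?B k) (online_schedule r \<alpha> select sched J)"
    using step[of K] U by simp
  show "respects_release r (online_schedule r \<alpha> select sched J)" unfolding respects_release_def
  proof (intro allI ballI)
    fix j t assume "t \<in> busy (online_schedule r \<alpha> select sched J) j"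
    then obtain k where "t \<in> busy (f k) j" unfolding online_schedule_def f_def[symmetric] busy_def by auto
    then have "j \<in> ?B k" "\<alpha> * \<tau> k \<le> t" using bf by auto
    then have "r j \<le> \<tau> k" using BP[of k] by (auto simp: pending_def)
    also have "\<tau> k \<le> \<alpha> * \<tau> k" using \<alpha> tau_mono(3)[of k] mult_right_mono[of 1 \<alpha> "\<tau> k"] by simp
    finally show "r j \<le> t" using \<open>\<alpha> * \<tau> k \<le> t\<close> by simp
  qed
qed

end


section \<open>Concurrent open shop is a scheduling environment\<close>

text \<open>
  Job \<open>j\<close> needs \<open>q i j\<close> units of processing on machine \<open>i\<close>; it may be processed by several
  machines at the same time, every machine processes at most one job at a time, and preemption
  is allowed.  A processing time of \<open>0\<close> means that the job has no operation on the machine.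
\<close>

definition concurrent_open_shop ::
    "'m set \<Rightarrow> ('m \<Rightarrow> 'j \<Rightarrow> real) \<Rightarrow> 'j set \<Rightarrow> ('j, 'm) schedule \<Rightarrow> bool" where
  "concurrent_open_shop M q S \<sigma> \<longleftrightarrow>
     (\<forall>j t. \<sigma> j t \<subseteq> M) \<and>
     (\<forall>j. \<forall>t\<in>busy \<sigma> j. j \<in> S \<and> 0 \<le> t) \<and>
     (\<forall>j. bdd_above (busy \<sigma> j)) \<and>
     (\<forall>t j j'. j \<noteq> j' \<longrightarrow> \<sigma> j t \<inter> \<sigma> j' t = {}) \<and>
     (\<forall>j t i. i \<in> \<sigma> j t \<longrightarrow> (\<exists>e>0. \<forall>u\<in>{t..<t+e}. i \<in> \<sigma> j u)) \<and>
     (\<forall>j\<in>S. \<forall>i\<in>M. {t. i \<in> \<sigma> j t} \<in> sets lborel \<and>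
        emeasure lborel {t. i \<in> \<sigma> j t} = ennreal (q i j))"

lemma completion_time_eq_Sup:
  assumes "busy \<sigma> j \<noteq> {}" "bdd_above (busy \<sigma> j)"
  shows "completion_time \<sigma> j = ereal (Sup (busy \<sigma> j))"
proof -
  obtain t where t: "t \<in> busy \<sigma> j" using assms by auto
  let ?X = "SUP t\<in>busy \<sigma> j. ereal t"
  have "ereal t \<le> ?X" using t by (rule SUP_upper)
  moreover have "?X \<le> ereal (Sup (busy \<sigma> j))" using assms by (auto intro!: SUP_least cSup_upper)
  ultimately have "\<bar>?X\<bar> \<noteq> \<infinity>" by auto
  then show ?thesis using assms ereal_Sup[of "busy \<sigma> j"] by (simp add: completion_time_def)
qed

lemma start_time_eq_Inf:
  assumes "busy \<sigma> j \<noteq> {}" "bdd_below (busy \<sigma> j)"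
  shows "start_time \<sigma> j = ereal (Inf (busy \<sigma> j))"
proof -
  obtain t where t: "t \<in> busy \<sigma> j" using assms by auto
  let ?X = "INF t\<in>busy \<sigma> j. ereal t"
  have "?X \<le> ereal t" using t by (rule INF_lower)
  moreover have "?X \<ge> ereal (Inf (busy \<sigma> j))" using assms by (auto intro!: INF_greatest cInf_lower)
  ultimately have "\<bar>?X\<bar> \<noteq> \<infinity>" by auto
  then show ?thesis using ereal_Inf[of "busy \<sigma> j"] by (simp add: start_time_def)
qed

lemma concurrent_open_shop_environment:
  fixes M :: "'m set" and q :: "'m \<Rightarrow> 'j \<Rightarrow> real"
  assumes M: "finite M"
    and q: "\<And>i j. i \<in> M \<Longrightarrow> q i j = 0 \<or> q i j \<ge> 1"
    and q1: "\<And>j. \<exists>i\<in>M. q i j \<noteq> 0"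
    and w: "\<And>j. w j \<ge> 0" and r: "\<And>j. r j \<ge> 0"
  shows "scheduling_environment (concurrent_open_shop M q) (\<lambda>j. Max ((\<lambda>i. q i j) ` M)) r w"
proof -
  let ?F = "concurrent_open_shop M q"
  let ?p = "\<lambda>j. Max ((\<lambda>i. q i j) ` M)"
  have pos: "\<exists>i\<in>M. q i j = ?p j \<and> q i j \<ge> 1" for j
  proof -
    have "M \<noteq> {}" using q1 by auto
    then have "?p j \<in> (\<lambda>i. q i j) ` M" using M by (intro Max_in) auto
    then obtain i where i: "i \<in> M" "q i j = ?p j" by auto
    obtain i' where i': "i' \<in> M" "q i' j \<noteq> 0" using q1 by auto
    have "q i' j \<le> ?p j" using i' M by auto
    then show ?thesis using i q[OF i'(1), of j] i'(2) by auto
  qed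
  have ne: "busy \<sigma> j \<noteq> {}" if "?F S \<sigma>" "j \<in> S" for S \<sigma> j
  proof
    assume b: "busy \<sigma> j = {}"
    obtain i where i: "i \<in> M" "q i j \<ge> 1" using pos by blast
    have "{t. i \<in> \<sigma> j t} = {}" using b by (auto simp: busy_def)
    then have "ennreal (q i j) = 0" using that i unfolding concurrent_open_shop_def by (metis emeasure_empty)
    then show False using i by (simp add: ennreal_eq_0_iff)
  qed
  have bb: "bdd_below (busy \<sigma> j)" "bdd_above (busy \<sigma> j)" if "?F S \<sigma>" for S \<sigma> j
    using that unfolding concurrent_open_shop_def bdd_below_def by (auto intro!: exI[of _ 0])
  have dM: "\<sigma> j t \<subseteq> M" if "?F S \<sigma>" for S \<sigma> j t
    using that by (simp add: concurrent_open_shop_def)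
  have dbusy: "j \<in> S" "0 \<le> t" if "?F S \<sigma>" "t \<in> busy \<sigma> j" for S \<sigma> j t
    using that by (auto simp: concurrent_open_shop_def)
  have ddisj: "\<sigma> j t \<inter> \<sigma> j' t = {}" if "?F S \<sigma>" "j \<noteq> j'" for S \<sigma> j j' t
    using that by (simp add: concurrent_open_shop_def)
  have dright: "\<exists>e>0. \<forall>u\<in>{t..<t+e}. i \<in> \<sigma> j u" if "?F S \<sigma>" "i \<in> \<sigma> j t" for S \<sigma> i j t
    using that by (simp add: concurrent_open_shop_def)
  have dmeas: "{t. i \<in> \<sigma> j t} \<in> sets lborel" "emeasure lborel {t. i \<in> \<sigma> j t} = ennreal (q i j)"
    if "?F S \<sigma>" "j \<in> S" "i \<in> M" for S \<sigma> i j
    using that by (simp_all add: concurrent_open_shop_def)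
  show ?thesis
  proof (unfold_locales, goal_cases)
    case (1 j) then show ?case by (rule w)
  next
    case (2 j) then show ?case by (rule r)
  next
    case (3 j) then show ?case using pos[of j] by auto
  next
    case (4 S \<sigma> j) then show ?case by (auto simp: concurrent_open_shop_def)
  next
    case (5 S \<sigma> j) then show ?case using completion_time_eq_Sup[OF ne bb(2)] by fastforce
  next
    case (6 S \<sigma> t j)
    then obtain i where i: "i \<in> \<sigma> j t" by (auto simp: busy_def)
    then obtain e where e: "e > 0" "\<forall>u\<in>{t..<t+e}. i \<in> \<sigma> j u" using dright[OF 6(1)] by blast
    have "t + e/2 \<in> busy \<sigma> j" using e by (auto simp: busy_def intro!: exI[of _ i])
    then have "t + e/2 \<le> Sup (busy \<sigma> j)" using bb(2)[OF 6(1)] by (rule cSup_upper)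
    then have "t < Sup (busy \<sigma> j)" using e by simp
    moreover have "busy \<sigma> j \<noteq> {}" using 6 by auto
    ultimately show ?case using completion_time_eq_Sup[OF _ bb(2)[OF 6(1)], of j] dbusy(2)[OF 6] by simp
  next
    case (7 S \<sigma> j)
    obtain i where i: "i \<in> M" "q i j = ?p j" "q i j \<ge> 1" using pos by blast
    let ?a = "Inf (busy \<sigma> j)" let ?b = "Sup (busy \<sigma> j)"
    have n: "busy \<sigma> j \<noteq> {}" using ne 7 by blast
    have ab: "?a \<le> ?b" using n bb[OF 7(1), of j] by (simp add: cInf_le_cSup)
    have "{t. i \<in> \<sigma> j t} \<subseteq> {?a..?b}"
      using bb[OF 7(1), of j] by (auto simp: busy_def intro!: cInf_lower cSup_upper)
    then have "emeasure lborel {t. i \<in> \<sigma> j t} \<le> emeasure lborel {?a..?b}" by (intro emeasure_mono) auto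
    then have "ennreal (q i j) \<le> ennreal (?b - ?a)" using dmeas(2)[OF 7 i(1)] ab by simp
    then have "q i j \<le> ?b - ?a" using ab i by (simp add: ennreal_le_iff)
    then show ?case using completion_time_eq_Sup[OF n bb(2)[OF 7(1)]] start_time_eq_Inf[OF n bb(1)[OF 7(1)]] i by simp
  next
    case (8 j)
    let ?s = "\<lambda>j' t. if j' = j then {i\<in>M. 0 \<le> t \<and> t < q i j} else {}"
    have "?F {j} ?s" unfolding concurrent_open_shop_def
    proof (intro conjI allI ballI impI)
      fix j'
      show "bdd_above (busy ?s j')"
      proof (rule bdd_aboveI)
        fix t assume "t \<in> busy ?s j'"
        then obtain i where "i \<in> M" "t < q i j" by (auto simp: busy_def split: if_splits)
        moreover have "q i j \<le> ?p j" using M \<open>i \<in> M\<close> by auto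
        ultimately show "t \<le> ?p j" by linarith
      qed
    next
      fix j' t i assume "i \<in> ?s j' t"
      then have *: "j' = j" "i \<in> M" "0 \<le> t" "t < q i j" by (auto split: if_splits)
      then show "\<exists>e>0. \<forall>u\<in>{t..<t+e}. i \<in> ?s j' u" by (intro exI[of _ "q i j - t"]) auto
    next
      fix j' i assume a: "j' \<in> {j}" "i \<in> M"
      then have "{t. i \<in> ?s j' t} = {0..<q i j}" by auto
      moreover have "0 \<le> q i j" using q[OF a(2), of j] by auto
      ultimately show "{t. i \<in> ?s j' t} \<in> sets lborel" "emeasure lborel {t. i \<in> ?s j' t} = ennreal (q i j')" using a by auto
    qed (auto simp: busy_def split: if_splits)
    then show ?case by blast
  next
    case (9 S \<sigma> S')
    have b: "busy (restrict_jobs S' \<sigma>) j = (if j \<in> S' then busy \<sigma> j else {})" for j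
      by (auto simp: busy_def restrict_jobs_def)
    show ?case unfolding concurrent_open_shop_def
    proof (intro conjI allI ballI impI)
      fix j t i assume "i \<in> restrict_jobs S' \<sigma> j t"
      then have *: "j \<in> S'" "i \<in> \<sigma> j t" by (auto simp: restrict_jobs_def split: if_splits)
      then show "\<exists>e>0. \<forall>u\<in>{t..<t+e}. i \<in> restrict_jobs S' \<sigma> j u"
        using dright[OF 9(1) *(2)] by (simp add: restrict_jobs_def)
    next
      fix j show "bdd_above (busy (restrict_jobs S' \<sigma>) j)" unfolding b using bb(2)[OF 9(1)] by simp
    next
      fix j t assume "t \<in> busy (restrict_jobs S' \<sigma>) j"
      then show "j \<in> S'" "0 \<le> t" unfolding b using dbusy[OF 9(1)] by (auto split: if_splits)
    next
      fix j i assume "j \<in> S'" "i \<in> M"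
      then show "{t. i \<in> restrict_jobs S' \<sigma> j t} \<in> sets lborel"
        "emeasure lborel {t. i \<in> restrict_jobs S' \<sigma> j t} = ennreal (q i j)"
        using dmeas[OF 9(1), of j i] 9(2) by (auto simp: restrict_jobs_def)
    qed (use dM[OF 9(1)] ddisj[OF 9(1)] in \<open>auto simp: restrict_jobs_def\<close>)
  next
    case (10 S \<sigma> s)
    have b: "busy (shift s \<sigma>) j = (\<lambda>t. s + t) ` busy \<sigma> j" for j
    proof (intro equalityI subsetI)
      fix t assume "t \<in> busy (shift s \<sigma>) j"
      then show "t \<in> (\<lambda>t. s + t) ` busy \<sigma> j"
        by (intro image_eqI[of _ _ "t - s"]) (simp_all add: busy_def shift_def)
    qed (auto simp: busy_def shift_def)
    have m2: "{t. i \<in> shift s \<sigma> j t} \<in> sets lborel \<and> emeasure lborel {t. i \<in> shift s \<sigma> j t} = ennreal (q i j)"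
      if "j \<in> S" "i \<in> M" for i j
    proof -
      let ?T = "{t. i \<in> \<sigma> j t}"
      have T: "?T \<in> sets lborel" "emeasure lborel ?T = ennreal (q i j)"
        using dmeas[OF 10(1) that] by auto
      have v: "{t. i \<in> shift s \<sigma> j t} = (\<lambda>t. -s + t) -` ?T \<inter> space lborel" by (auto simp: shift_def)
      have f: "(\<lambda>t. -s + t) \<in> lborel \<rightarrow>\<^sub>M lborel" by simp
      have "emeasure lborel ?T = emeasure (distr lborel borel (\<lambda>t. -s + t)) ?T"
        by (simp only: lborel_distr_plus)
      also have "\<dots> = emeasure lborel ((\<lambda>t. -s + t) -` ?T \<inter> space lborel)"
        using T(1) by (intro emeasure_distr) auto
      finally show ?thesis using T f v measurable_sets[OF f T(1)] by simp
    qed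
    show ?case unfolding concurrent_open_shop_def
    proof (intro conjI allI ballI impI)
      fix j t i assume "i \<in> shift s \<sigma> j t"
      then have "i \<in> \<sigma> j (t - s)" by (simp add: shift_def)
      then obtain e where e: "e > 0" "\<forall>u\<in>{t-s..<t-s+e}. i \<in> \<sigma> j u" using dright[OF 10(1)] by blast
      then show "\<exists>e>0. \<forall>u\<in>{t..<t+e}. i \<in> shift s \<sigma> j u" 
        by (intro exI[of _ e]) (auto simp: shift_def)
    next
      fix j show "bdd_above (busy (shift s \<sigma>) j)" unfolding b
        using bb(2)[OF 10(1), of j] by (meson bdd_above_image_mono mono_add)
    next
      fix j t assume "t \<in> busy (shift s \<sigma>) j"
      then show "j \<in> S" "0 \<le> t" unfolding b using dbusy[OF 10(1)] 10(2) by force+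
    next
      fix t and j j' :: 'j assume "j \<noteq> j'"
      then show "shift s \<sigma> j t \<inter> shift s \<sigma> j' t = {}" using ddisj[OF 10(1)] by (simp add: shift_def)
    next
      fix j t show "shift s \<sigma> j t \<subseteq> M" using dM[OF 10(1)] by (simp add: shift_def)
    qed (use m2 in blast)+
  next
    case (11 S \<sigma> S' \<sigma>' b)
    have c: "busy (combine \<sigma> \<sigma>') j = busy \<sigma> j \<union> busy \<sigma>' j" for j by (auto simp: busy_def combine_def)
    have z: "\<sigma> j t = {}" if "j \<notin> S \<or> \<not> t < b" for j t using dbusy(1)[OF 11(1), of t j] 11(4)[of j] that
      unfolding busy_def by blast
    have z': "\<sigma>' j t = {}" if "j \<notin> S' \<or> \<not> b \<le> t" for j t using dbusy(1)[OF 11(2), of t j] 11(5)[of j] that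
      unfolding busy_def by blast
    show ?case unfolding concurrent_open_shop_def
    proof (intro conjI allI ballI impI)
      fix j t show "combine \<sigma> \<sigma>' j t \<subseteq> M" using dM[OF 11(1)] dM[OF 11(2)] by (auto simp: combine_def)
    next
      fix j t assume "t \<in> busy (combine \<sigma> \<sigma>') j"
      then show "j \<in> S \<union> S'" "0 \<le> t" unfolding c using dbusy[OF 11(1), of t j] dbusy[OF 11(2), of t j] by auto
    next
      fix j show "bdd_above (busy (combine \<sigma> \<sigma>') j)" unfolding c using bb(2)[OF 11(1)] bb(2)[OF 11(2)] by simp
    next
      fix t and j j' :: 'j assume "j \<noteq> j'"
      then have "\<sigma> j t \<inter> \<sigma> j' t = {}" "\<sigma>' j t \<inter> \<sigma>' j' t = {}"
        using ddisj[OF 11(1)] ddisj[OF 11(2)] by auto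
      then show "combine \<sigma> \<sigma>' j t \<inter> combine \<sigma> \<sigma>' j' t = {}"
        using z z' unfolding combine_def by (cases "t < b") auto
    next
      fix j t i assume "i \<in> combine \<sigma> \<sigma>' j t"
      then consider "i \<in> \<sigma> j t" | "i \<in> \<sigma>' j t" by (auto simp: combine_def)
      then show "\<exists>e>0. \<forall>u\<in>{t..<t+e}. i \<in> combine \<sigma> \<sigma>' j u"
      proof cases
        case 1 then show ?thesis using dright[OF 11(1)] unfolding combine_def by blast
      next
        case 2 then show ?thesis using dright[OF 11(2)] unfolding combine_def by blast
      qed
    next
      fix j i assume "j \<in> S \<union> S'" "i \<in> M"
      then consider "j \<in> S" "{t. i \<in> combine \<sigma> \<sigma>' j t} = {t. i \<in> \<sigma> j t}"
        | "j \<in> S'" "{t. i \<in> combine \<sigma> \<sigma>' j t} = {t. i \<in> \<sigma>' j t}"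
      proof (cases "j \<in> S")
        case True
        then have "\<sigma>' j t = {}" for t using z'[of j t] 11(3) by blast
        then show ?thesis using that(1) True by (simp add: combine_def)
      next
        case False
        then have "\<sigma> j t = {}" for t using z[of j t] by blast
        then show ?thesis using that(2) False \<open>j \<in> S \<union> S'\<close> by (simp add: combine_def)
      qed
      note * = this
      show "{t. i \<in> combine \<sigma> \<sigma>' j t} \<in> sets lborel"
        using * dmeas[OF 11(1), of j i] dmeas[OF 11(2), of j i] \<open>i \<in> M\<close> by cases auto
      show "emeasure lborel {t. i \<in> combine \<sigma> \<sigma>' j t} = ennreal (q i j)"
        using * dmeas[OF 11(1), of j i] dmeas[OF 11(2), of j i] \<open>i \<in> M\<close> by cases auto
    qed
  qed
qed

end

theory Submission
  imports Defs
begin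

text \<open>
  A job of batch \<open>k\<close> starts at \<open>\<alpha> * \<tau> k\<close>, and the costs within the batches add up to at most
  \<open>\<gamma>\<close> times the optimum, because the optimal schedule may be restricted to each batch.
  The offsets \<open>\<tau> k\<close>, summed by parts, become the sum of \<open>(\<tau> (k + 1) - \<tau> k)\<close> times the weight
  left over after round \<open>k\<close>.  The jobs that the optimal schedule completes by \<open>\<tau> k\<close> are released
  by \<open>\<tau> k\<close> and fit into an interval of length \<open>\<tau> (k + 1) - \<tau> k \<ge> \<tau> k\<close>; so the left-over weight
  is at most \<open>\<beta>\<close> times the weight that is unfinished at \<open>\<tau> k\<close> in the optimal schedule.  The
  \<open>\<tau> k\<close> below the completion time \<open>c\<close> of a job form a geometric sum of at most \<open>2 * c\<close>.  Only
  round \<open>0\<close>, where \<open>\<tau> 1 - \<tau> 0 = 1\<close> exceeds \<open>\<tau> 0 = 0\<close>, causes the additive term.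
\<close>

section \<open>Sums over the interval endpoints\<close>

lemma tau_Suc_diff: "\<tau> (Suc k) - \<tau> k = \<tau> k + (if k = 0 then 1 else 0)"
  by (cases k) (simp_all add: \<tau>_def)

lemma tau_unbounded: "\<exists>k. c \<le> \<tau> k"
proof -
  obtain n where "c < 2 ^ n"
    using real_arch_pow[of 2 c] by auto
  then show ?thesis
    by (intro exI[of _ "Suc n"]) (simp add: \<tau>_def)
qed

lemma sum_tau_le: "(\<Sum>k<Suc K. \<tau> k) \<le> 2 * \<tau> K"
proof (induction K)
  case 0
  show ?case by (simp add: \<tau>_def)
next
  case (Suc K)
  then show ?case using tau_Suc_diff[of K] by (simp split: if_splits)
qed

text \<open>The last endpoint below \<open>c\<close> decides: the endpoints up to it form a
  geometric sum of at most twice the last one, and all later terms vanish.\<close>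

lemma sum_tau_below_le:
  assumes "0 \<le> c"
  shows "(\<Sum>k<K. if \<tau> k < c then \<tau> k else 0) \<le> 2 * c"
proof (induction K)
  case 0
  then show ?case using assms by simp
next
  case (Suc K)
  show ?case
  proof (cases "\<tau> K < c")
    case True
    have "(\<Sum>k<Suc K. if \<tau> k < c then \<tau> k else 0) \<le> (\<Sum>k<Suc K. \<tau> k)"
      by (intro sum_mono) (simp add: tau_mono(3))
    then show ?thesis using sum_tau_le[of K] True by linarith
  qed (use Suc in simp)
qed

text \<open>Abel summation. The boundary term at the start vanishes because
  \<open>\<tau> 0 = 0\<close>.\<close>

lemma sum_tau_by_parts:
  "(\<Sum>k<K. \<tau> k * (P k - P (Suc k))) + \<tau> K * P K = (\<Sum>k<K. (\<tau> (Suc k) - \<tau> k) * P (Suc k))"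
proof (induction K)
  case 0
  show ?case by (simp add: \<tau>_def)
qed (simp add: algebra_simps)

lemma busy_nonempty: "completion_time \<sigma> j < \<infinity> \<Longrightarrow> busy \<sigma> j \<noteq> {}"
  by (auto simp: completion_time_def)

lemma completion_time_restrict_jobs:
  "j \<in> S \<Longrightarrow> completion_time (restrict_jobs S \<sigma>) j = completion_time \<sigma> j"
  by (simp add: completion_time_def busy_def restrict_jobs_def)

lemma min_unscheduled_weight_le:
  assumes "finite R" "S \<subseteq> R" "completable feasible S D"
  shows "min_unscheduled_weight feasible w R D \<le> sum w (R - S)"
proof -
  have "{sum w (R - S) | S. S \<subseteq> R \<and> completable feasible S D} \<subseteq> (\<lambda>S. sum w (R - S)) ` Pow R"
    by auto
  then have "finite {sum w (R - S) | S. S \<subseteq> R \<and> completable feasible S D}"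
    using assms(1) by (meson finite_Pow_iff finite_imageI finite_subset)
  then show ?thesis
    unfolding min_unscheduled_weight_def using assms by (intro Min_le) auto
qed

locale online_algorithm = scheduling_environment feasible p r w
  for feasible :: "'j set \<Rightarrow> ('j, 'm) schedule \<Rightarrow> bool" and p r w :: "'j \<Rightarrow> real" +
  fixes \<alpha> \<beta> \<gamma> :: real
    and select :: "'j set \<Rightarrow> real \<Rightarrow> 'j set"
    and sched :: "'j set \<Rightarrow> ('j, 'm) schedule"
    and J :: "'j set"
    and opt :: "('j, 'm) schedule"
  assumes alpha: "\<alpha> \<ge> 1" and beta: "\<beta> \<ge> 1" and gamma: "\<gamma> \<ge> 1"
    and muwp: "muwp_approximation feasible w \<alpha> \<beta> select"
    and appr: "offline_approximation feasible w \<gamma> sched"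
    and finite_J: "finite J"
    and feasible_opt: "feasible J opt"
    and release_opt: "respects_release r opt"
begin

abbreviation "B \<equiv> batch r select J"
abbreviation "A \<equiv> assigned r select J"
abbreviation "R \<equiv> pending r select J"

text \<open>A real-valued copy, used only for jobs in \<open>J\<close>, whose completion times in
  \<open>opt\<close> are finite.\<close>

definition c :: "'j \<Rightarrow> real" where
  "c j = real_of_ereal (completion_time opt j)"

text \<open>Any time \<open>t\<close> at which \<open>opt\<close> processes \<open>j\<close> gives
  all three facts: it is nonnegative, not before the release of \<open>j\<close>, and strictly
  before its completion.\<close>

lemma
  assumes "j \<in> J"
  shows completion_time_opt: "completion_time opt j = ereal (c j)"
    and c_nonneg: "0 \<le> c j"
    and release_less_c: "r j < c j"
proof -
  have fin: "completion_time opt j < \<infinity>"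
    using feasible_finite[OF feasible_opt assms] .
  then obtain t where t: "t \<in> busy opt j" using busy_nonempty by fastforce
  have *: "0 \<le> t" "ereal t < completion_time opt j" "r j \<le> t"
    using feasible_time[OF feasible_opt t] release_opt t by (auto simp: respects_release_def)
  show eq: "completion_time opt j = ereal (c j)"
    unfolding c_def using fin * by (cases "completion_time opt j") auto
  show "0 \<le> c j" "r j < c j" using * eq by auto
qed

section \<open>Disjointness and inclusion of the batches\<close>

lemma finite_pending: "finite (R k)"
  using finite_J by (simp add: pending_def)

lemma batch_subset: "B k \<subseteq> R k"
  using muwp finite_pending[of k] tau_mono(2)[of k]
  unfolding muwp_approximation_def batch_def by auto

lemma finite_batch: "finite (B k)"
  using batch_subset finite_pending finite_subset by blast

lemma assigned_Suc: "A (Suc k) = A k \<union> B k"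
  by (simp add: batch_def pending_def)

lemma batch_disjoint: "A k \<inter> B k = {}"
  using batch_subset[of k] by (auto simp: pending_def)

lemma assigned_eq: "A K = (\<Union>k<K. B k)"
  by (induction K) (auto simp: assigned_Suc lessThan_Suc simp del: assigned.simps(2))

lemma batch_inter:
  assumes "k \<noteq> l"
  shows "B k \<inter> B l = {}"
  using assms
proof (induction k l rule: linorder_wlog)
  case (le k l)
  then show ?case using batch_disjoint[of l] by (fastforce simp: assigned_eq)
qed blast

lemma assigned_subset: "A k \<subseteq> J"
  using batch_subset by (auto simp: assigned_eq pending_def)

lemma batch_subset_J: "B k \<subseteq> J"
  using batch_subset by (auto simp: pending_def)

section \<open>Cost of a single batch\<close>

lemma feasible_sched: "feasible (B k) (sched (B k))"
  using appr finite_batch unfolding offline_approximation_def by blast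

text \<open>The online schedule is a union over all rounds, but the batches are disjoint and each
  schedule processes only its own jobs, so \<open>j\<close> is busy only in round
  \<open>k\<close>.\<close>

lemma completion_time_online_le:
  assumes j: "j \<in> B k"
  shows "completion_time (online_schedule r \<alpha> select sched J) j
    \<le> ereal (\<alpha> * \<tau> k) + completion_time (sched (B k)) j"
proof -
  let ?\<sigma> = "online_schedule r \<alpha> select sched J"
  have eq: "busy ?\<sigma> j = (\<Union>l. busy (shift (\<alpha> * \<tau> l) (sched (B l))) j)"
    by (auto simp: busy_def online_schedule_def)
  obtain t where "t \<in> busy (sched (B k)) j"
    using busy_nonempty[OF feasible_finite[OF feasible_sched j]] by auto
  then have "\<alpha> * \<tau> k + t \<in> busy (shift (\<alpha> * \<tau> k) (sched (B k))) j"
    by (simp add: busy_shift)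
  \<comment> \<open>This excludes the default value \<open>\<infinity>\<close> of
    \<open>completion_time\<close>.\<close>
  then have ne: "busy ?\<sigma> j \<noteq> {}"
    unfolding eq by blast
  have "ereal t \<le> ereal (\<alpha> * \<tau> k) + completion_time (sched (B k)) j" if t: "t \<in> busy ?\<sigma> j" for t
  proof -
    obtain l where l: "t - \<alpha> * \<tau> l \<in> busy (sched (B l)) j"
      using t unfolding eq by (auto simp: busy_shift)
    then have "j \<in> B l" using feasible_outside[OF feasible_sched] by blast
    with j batch_inter have "l = k" by blast
    then have "ereal (t - \<alpha> * \<tau> k) \<le> completion_time (sched (B k)) j"
      using l by (blast intro: le_completion)
    then show ?thesis
      by (cases "completion_time (sched (B k)) j") auto
  qed
  then show ?thesis
    using ne by (auto simp: completion_time_def[of ?\<sigma>] intro!: SUP_least)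
qed

text \<open>Restricting \<open>opt\<close> to the batch keeps completion times, so the restriction
  is a candidate in the infimum \<open>offline_optimum\<close>.\<close>

lemma cost_batch_le: "cost w (B k) (sched (B k)) \<le> ereal (\<gamma> * (\<Sum>j\<in>B k. w j * c j))"
proof -
  let ?\<rho> = "restrict_jobs (B k) opt"
  have "feasible (B k) ?\<rho>"
    using feasible_restrict[OF feasible_opt batch_subset_J] .
  then have "offline_optimum feasible w (B k) \<le> cost w (B k) ?\<rho>"
    unfolding offline_optimum_def by (intro INF_lower) simp
  also have "\<dots> = (\<Sum>j\<in>B k. ereal (w j * c j))"
    unfolding cost_def
  proof (rule sum.cong[OF refl])
    fix j assume "j \<in> B k"
    then show "ereal (w j) * completion_time ?\<rho> j = ereal (w j * c j)"
      using batch_subset_J completion_time_opt[of j]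
      by (simp add: completion_time_restrict_jobs subset_eq)
  qed
  finally have "ereal \<gamma> * offline_optimum feasible w (B k)
      \<le> ereal \<gamma> * ereal (\<Sum>j\<in>B k. w j * c j)"
    using gamma by (intro ereal_mult_left_mono) auto
  moreover have "cost w (B k) (sched (B k)) \<le> ereal \<gamma> * offline_optimum feasible w (B k)"
    using appr finite_batch unfolding offline_approximation_def by blast
  ultimately show ?thesis by simp
qed

lemma cost_online_batch_le:
  "cost w (B k) (online_schedule r \<alpha> select sched J)
    \<le> ereal (\<alpha> * (\<tau> k * sum w (B k)) + \<gamma> * (\<Sum>j\<in>B k. w j * c j))"
proof -
  have "cost w (B k) (online_schedule r \<alpha> select sched J)
      \<le> (\<Sum>j\<in>B k. ereal (w j) * (ereal (\<alpha> * \<tau> k) + completion_time (sched (B k)) j))"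
    unfolding cost_def
    by (intro sum_mono ereal_mult_left_mono completion_time_online_le) (simp_all add: weight_nonneg)
  also have "\<dots> = (\<Sum>j\<in>B k. ereal (\<alpha> * \<tau> k * w j) + ereal (w j) * completion_time (sched (B k)) j)"
    by (intro sum.cong refl) (simp add: distrib_left ereal_distrib_left mult.commute)
  also have "\<dots> = ereal (\<alpha> * (\<tau> k * sum w (B k))) + cost w (B k) (sched (B k))"
    by (simp add: sum.distrib cost_def sum_distrib_left mult.assoc)
  also have "\<dots> \<le> ereal (\<alpha> * (\<tau> k * sum w (B k))) + ereal (\<gamma> * (\<Sum>j\<in>B k. w j * c j))"
    by (intro add_left_mono cost_batch_le)
  finally show ?thesis by simp
qed

section \<open>Weight left over after each round\<close>

lemma left_over_weight_le:
  "sum w (J - A (Suc k)) \<le> \<beta> * sum w {j\<in>J. \<tau> k < c j}"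
proof -
  let ?D = "\<tau> (Suc k) - \<tau> k"
  let ?S = "{j\<in>R k. c j \<le> \<tau> k}"
  have SJ: "?S \<subseteq> J" by (auto simp: pending_def)
  have "completes_by ?S (restrict_jobs ?S opt) ?D"
    unfolding completes_by_def
  proof
    fix j assume j: "j \<in> ?S"
    then have "j \<in> J" using SJ by blast
    then have "completion_time (restrict_jobs ?S opt) j = ereal (c j)"
      unfolding completion_time_restrict_jobs[OF j] by (rule completion_time_opt)
    \<comment> \<open>The restriction of \<open>opt\<close> is used without a shift, so an interval
      as long as \<open>\<tau> k\<close> suffices.\<close>
    moreover have "c j \<le> ?D" using j tau_Suc_diff[of k] by auto
    ultimately show "completion_time (restrict_jobs ?S opt) j \<le> ereal ?D" by simp
  qed
  then have "completable feasible ?S ?D"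
    unfolding completable_def using feasible_restrict[OF feasible_opt SJ] by blast
  then have "min_unscheduled_weight feasible w (R k) ?D \<le> sum w (R k - ?S)"
    using finite_pending by (intro min_unscheduled_weight_le) auto
  moreover have "sum w (R k - B k) \<le> \<beta> * min_unscheduled_weight feasible w (R k) ?D"
    using muwp finite_pending[of k] tau_mono(2)[of k]
    unfolding muwp_approximation_def batch_def by auto
  ultimately have 1: "sum w (R k - B k) \<le> \<beta> * sum w (R k - ?S)"
    using beta by (meson mult_left_mono order_trans zero_le_one)
  \<comment> \<open>Jobs not yet released are outside the MUWP guarantee; as
    \<open>\<beta> \<ge> 1\<close>, their weight fits the same bound.\<close>
  let ?N = "{j\<in>J. \<tau> k < r j} - A k"
  have "0 \<le> sum w ?N" by (simp add: sum_nonneg weight_nonneg)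
  then have 2: "sum w ?N \<le> \<beta> * sum w ?N"
    using beta mult_right_mono[of 1 \<beta>] by simp
  have "J - A (Suc k) = (R k - B k) \<union> ?N"
    using batch_subset_J[of k] batch_subset[of k]
    by (auto simp: assigned_Suc pending_def simp del: assigned.simps(2))
  then have "sum w (J - A (Suc k)) = sum w (R k - B k) + sum w ?N"
    using finite_pending finite_J by (simp, intro sum.union_disjoint) (auto simp: pending_def)
  also have "\<dots> \<le> \<beta> * (sum w (R k - ?S) + sum w ?N)"
    using 1 2 by (simp add: distrib_left)
  also have "sum w (R k - ?S) + sum w ?N = sum w ((R k - ?S) \<union> ?N)"
    using finite_pending finite_J by (intro sum.union_disjoint[symmetric]) (auto simp: pending_def)
  \<comment> \<open>Both kinds of jobs are unfinished in \<open>opt\<close> at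
    \<open>\<tau> k\<close>: the first by definition of \<open>?S\<close>, the second because a job
    completes after its release.\<close>
  also have "\<beta> * \<dots> \<le> \<beta> * sum w {j\<in>J. \<tau> k < c j}"
    using beta finite_J release_less_c
    by (intro mult_left_mono sum_mono2) (force simp: pending_def weight_nonneg)+
  finally show ?thesis .
qed

lemma sum_offsets_le:
  "(\<Sum>k<K. \<tau> k * sum w (B k)) \<le> 2 * \<beta> * (\<Sum>j\<in>J. w j * c j) + sum w J"
proof -
  let ?P = "\<lambda>k. sum w (J - A k)"
  let ?V = "\<lambda>k. sum w {j\<in>J. \<tau> k < c j}"
  have P: "0 \<le> ?P k" "?P k \<le> sum w J" for k
    using finite_J by (auto intro!: sum_nonneg sum_mono2 simp: weight_nonneg)
  have B: "sum w (B k) = ?P k - ?P (Suc k)" for k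
  proof -
    have "J - A k - B k = J - A (Suc k)" unfolding assigned_Suc by blast
    moreover have "B k \<subseteq> J - A k" using batch_subset_J batch_disjoint by blast
    ultimately show ?thesis using finite_J sum_diff[of "J - A k" "B k" w] by simp
  qed
  \<comment> \<open>The batch weights telescope in \<open>?P\<close>; the boundary term at
    \<open>K\<close> is nonnegative and dropped.\<close>
  have "(\<Sum>k<K. \<tau> k * sum w (B k)) \<le> (\<Sum>k<K. (\<tau> (Suc k) - \<tau> k) * ?P (Suc k))"
    unfolding B using sum_tau_by_parts[of ?P K] mult_nonneg_nonneg[OF tau_mono(3)[of K] P(1)[of K]]
    by linarith
  \<comment> \<open>In round 0 the factor is 1 while \<open>\<tau> 0 = 0\<close>, so the left-over
    weight is bounded by the total weight instead.\<close>
  also have "\<dots> \<le> (\<Sum>k<K. \<tau> k * (\<beta> * ?V k) + (if k = 0 then sum w J else 0))"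
  proof (rule sum_mono)
    fix k
    have "\<tau> k * ?P (Suc k) \<le> \<tau> k * (\<beta> * ?V k)"
      by (intro mult_left_mono left_over_weight_le tau_mono(3))
    then show "(\<tau> (Suc k) - \<tau> k) * ?P (Suc k)
        \<le> \<tau> k * (\<beta> * ?V k) + (if k = 0 then sum w J else 0)"
      unfolding tau_Suc_diff using P(2)[of "Suc k"]
      by (cases "k = 0") (simp_all add: distrib_right del: assigned.simps(2))
  qed
  also have "\<dots> \<le> (\<Sum>k<K. \<tau> k * (\<beta> * ?V k)) + sum w J"
    using P(2)[of 0] P(1)[of 0] by (simp add: sum.distrib sum.delta)
  \<comment> \<open>Each job is charged \<open>\<tau> k\<close> in every round where
    \<open>opt\<close> has not finished it by \<open>\<tau> k\<close>; swapping the sums collects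
    the charges per job.\<close>
  also have "(\<Sum>k<K. \<tau> k * (\<beta> * ?V k)) = \<beta> * (\<Sum>k<K. \<Sum>j\<in>J. w j * (if \<tau> k < c j then \<tau> k else 0))"
  proof -
    have "\<tau> k * ?V k = (\<Sum>j\<in>J. w j * (if \<tau> k < c j then \<tau> k else 0))" for k
      using finite_J by (simp add: sum_distrib_left sum.inter_filter mult.commute if_distrib cong: if_cong)
    then show ?thesis by (simp add: mult.left_commute[of _ \<beta>] flip: sum_distrib_left)
  qed
  also have "\<dots> = \<beta> * (\<Sum>j\<in>J. w j * (\<Sum>k<K. if \<tau> k < c j then \<tau> k else 0))"
    by (subst sum.swap) (simp add: sum_distrib_left)
  also have "\<dots> \<le> \<beta> * (\<Sum>j\<in>J. w j * (2 * c j))"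
    using beta by (intro mult_left_mono sum_mono sum_tau_below_le) (simp_all add: weight_nonneg c_nonneg)
  also have "\<dots> = 2 * \<beta> * (\<Sum>j\<in>J. w j * c j)"
    by (simp add: sum_distrib_left mult_ac)
  finally show ?thesis by simp
qed

section \<open>Summation over all batches\<close>

text \<open>Once \<open>\<tau> k\<close> reaches every \<open>c j\<close>, the bound on the
  left-over weight is 0. Jobs of weight 0 may still never be selected.\<close>

lemma eventually_all_weight_assigned: "\<exists>K. \<forall>j\<in>J - A K. w j = 0"
proof -
  \<comment> \<open>The inserted 0 covers an empty \<open>J\<close>.\<close>
  obtain k where k: "Max (insert 0 (c ` J)) \<le> \<tau> k"
    using tau_unbounded by blast
  then have *: "{j\<in>J. \<tau> k < c j} = {}"
    using finite_J by (auto simp: not_less)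
  have "sum w (J - A (Suc k)) \<le> 0"
    using left_over_weight_le[of k] unfolding * by simp
  then have "\<forall>j\<in>J - A (Suc k). w j = 0"
    using sum_nonneg_eq_0_iff[of "J - A (Suc k)" w] finite_J
    by (metis finite_Diff sum_nonneg weight_nonneg order_antisym)
  then show ?thesis by blast
qed

theorem cost_online_le:
  "cost w J (online_schedule r \<alpha> select sched J)
    \<le> ereal (2 * \<alpha> * \<beta> + \<gamma>) * cost w J opt + ereal (\<alpha> * sum w J)"
proof -
  let ?\<sigma> = "online_schedule r \<alpha> select sched J"
  let ?C = "\<Sum>j\<in>J. w j * c j"
  obtain K where K: "\<forall>j\<in>J - A K. w j = 0"
    using eventually_all_weight_assigned by blast
  \<comment> \<open>Polymorphic, as it serves both extended real costs and real sums.\<close>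
  have UN: "sum f (A K) = (\<Sum>k<K. sum f (B k))" for f :: "'j \<Rightarrow> 'a::comm_monoid_add"
    unfolding assigned_eq using finite_batch batch_inter by (intro sum.UNION_disjoint) auto
  \<comment> \<open>A job outside \<open>A K\<close> has weight 0 and contributes 0 even if its
    completion time is \<open>\<infinity>\<close>.\<close>
  have "cost w J ?\<sigma> = cost w (A K) ?\<sigma>"
    unfolding cost_def using K finite_J assigned_subset by (intro sum.mono_neutral_right) auto
  also have "\<dots> = (\<Sum>k<K. cost w (B k) ?\<sigma>)"
    unfolding cost_def UN ..
  also have "\<dots> \<le> (\<Sum>k<K. ereal (\<alpha> * (\<tau> k * sum w (B k)) + \<gamma> * (\<Sum>j\<in>B k. w j * c j)))"
    by (intro sum_mono cost_online_batch_le)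
  also have "\<dots> = ereal (\<alpha> * (\<Sum>k<K. \<tau> k * sum w (B k)) + \<gamma> * (\<Sum>j\<in>A K. w j * c j))"
    by (simp add: UN sum.distrib sum_distrib_left)
  also have "\<dots> \<le> ereal (\<alpha> * (2 * \<beta> * ?C + sum w J) + \<gamma> * ?C)"
  proof -
    have "(\<Sum>j\<in>A K. w j * c j) \<le> ?C"
      using finite_J assigned_subset by (intro sum_mono2) (auto simp: weight_nonneg c_nonneg)
    then show ?thesis
      using alpha gamma sum_offsets_le[of K] by (simp add: add_mono mult_left_mono)
  qed
  also have "\<dots> = ereal (2 * \<alpha> * \<beta> + \<gamma>) * ereal ?C + ereal (\<alpha> * sum w J)"
    by (simp add: algebra_simps)
  also have "ereal ?C = cost w J opt"
    by (simp add: cost_def completion_time_opt flip: sum_ereal)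
  finally show ?thesis .
qed

end

theorem theorem1:
  fixes feasible :: "'j set \<Rightarrow> ('j, 'm) schedule \<Rightarrow> bool"
    and p r w :: "'j \<Rightarrow> real"
    and \<alpha> \<beta> \<gamma> :: real
    and select :: "'j set \<Rightarrow> real \<Rightarrow> 'j set"
    and sched :: "'j set \<Rightarrow> ('j, 'm) schedule"
    and J :: "'j set"
    and opt :: "('j, 'm) schedule"
  assumes "scheduling_environment feasible p r w"
    and "\<alpha> \<ge> 1" and "\<beta> \<ge> 1" and "\<gamma> \<ge> 1"
    and "muwp_approximation feasible w \<alpha> \<beta> select"
    and "offline_approximation feasible w \<gamma> sched"
    and "finite J"
    and "optimal_offline feasible r w J opt"
  shows "(\<Sum>j\<in>J. ereal (w j) * completion_time (online_schedule r \<alpha> select sched J) j)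
    \<le> ereal (2 * \<alpha> * \<beta> + \<gamma>) * (\<Sum>j\<in>J. ereal (w j) * completion_time opt j)
      + ereal (\<alpha> * (\<Sum>j\<in>J. w j))"
proof -
  interpret scheduling_environment feasible p r w
    by fact
  interpret online_algorithm feasible p r w \<alpha> \<beta> \<gamma> select sched J opt
    using assms by unfold_locales (auto simp: optimal_offline_def)
  show ?thesis
    using cost_online_le unfolding cost_def .
qed

end
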